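(* Let $\theta$ be a real constant and let $u$ be a complex number (the Laplace parameter) with $\operatorname{Re}(u)>0$. The Laplace integral (transform) of the Gaussian is $$\int_0^{+\infty}e^{-\theta^2x^2}e^{-ux}\,dx=\frac1u\,{}_2F_0\left(\frac12,1;\,;-\frac{4\theta^2}{u^2}\right).$$ Therefore, that of the error function $\operatorname{erf}(x)=\int_0^x e^{-v^2}\,dv$ is given by $$\int_0^{+\infty}\operatorname{erf}(x)\,e^{-ux}\,dx=\frac1u\int_0^{+\infty}e^{-x^2}e^{-ux}\,dx=\frac1{u^2}\,{}_2F_0\left(\frac12,1;\,;-\frac{4}{u^2}\right).$$
   Context: The paper's error function carries no normalizing factor: $\operatorname{erf}(x)=\int_0^x e^{-v^2}\,dv$. The generalized hypergeometric function is defined by the series $${}_pF_q(a_1,\dots,a_p;b_1,\dots,b_q;x)=\sum_{n=0}^{\infty}\frac{(a_1)_n\cdots(a_p)_n}{(b_1)_n\cdots(b_q)_n}\frac{x^n}{n!},$$ with Pochhammer symbol $(\vartheta)_n=\Gamma(\vartheta+n)/\Gamma(\vartheta)$, $(\vartheta)_0=1$; thus ${}_2F_0(a,b;\,;z)$ denotes the series $\sum_{n\ge0}(a)_n(b)_n z^n/n!$.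
   Formalization: The series 2F0(1/2,1;;z) diverges for every z ≠ 0, so the equalities are stated with its Borel sum (ordinary sum if θ = 0); the literal series is also shown to be an asymptotic expansion of both transforms as u → ∞ in Re(u) > 0. *)

theory Defs
  imports "HOL-Complex_Analysis.Complex_Analysis" "HOL-Library.Landau_Symbols"
begin

text \<open>
  The error function without the usual factor $2/\sqrt{\pi}$.
\<close>

definition erf :: "real \<Rightarrow> real" where
  "erf x = (LBINT v=ereal 0..ereal x. exp (- (v\<^sup>2)))"

definition laplace :: "(real \<Rightarrow> real) \<Rightarrow> complex \<Rightarrow> complex" where
  "laplace f u = integral {0..} (\<lambda>x. complex_of_real (f x) * exp (- u * complex_of_real x))"

definition laplace_exists :: "(real \<Rightarrow> real) \<Rightarrow> complex \<Rightarrow> bool" where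
  "laplace_exists f u \<longleftrightarrow>
     (\<lambda>x. complex_of_real (f x) * exp (- u * complex_of_real x)) integrable_on {0..}"

text \<open>
  Borel summation of a series $\sum_n a_n$: its Borel transform $\sum_n a_n t^n / n!$ converges
  near $0$, continues analytically along $[0,\infty)$ to some $B$, and
  $S = \int_0^\infty e^{-t} B(t)\,dt$.
\<close>

definition borel_sums :: "(nat \<Rightarrow> complex) \<Rightarrow> complex \<Rightarrow> bool" where
  "borel_sums a S \<longleftrightarrow> (\<exists>B U. open U \<and> connected U \<and> complex_of_real ` {0..} \<subseteq> U \<and>
     B holomorphic_on U \<and> B has_fps_expansion Abs_fps (\<lambda>n. a n / fact n) \<and>
     ((\<lambda>t. exp (- complex_of_real t) * B (complex_of_real t)) has_integral S) {0..})"

lemma borel_sums_unique: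
  assumes "borel_sums a S" "borel_sums a T"
  shows "S = T"
proof -
  obtain B U where B: "open U" "complex_of_real ` {0..} \<subseteq> U"
    "B holomorphic_on U" "B has_fps_expansion Abs_fps (\<lambda>n. a n / fact n)"
    "((\<lambda>t. exp (- complex_of_real t) * B (complex_of_real t)) has_integral S) {0..}"
    using assms(1) unfolding borel_sums_def by blast
  obtain C V where C: "open V" "complex_of_real ` {0..} \<subseteq> V"
    "C holomorphic_on V" "C has_fps_expansion Abs_fps (\<lambda>n. a n / fact n)"
    "((\<lambda>t. exp (- complex_of_real t) * C (complex_of_real t)) has_integral T) {0..}"
    using assms(2) unfolding borel_sums_def by blast
  define W where "W = connected_component_set (U \<inter> V) 0"
  have W: "open W" "connected W" "W \<subseteq> U" "W \<subseteq> V"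
    using B(1) C(1) connected_component_subset[of "U \<inter> V" 0]
    by (auto simp: W_def open_connected_component open_Int)
  have "connected (complex_of_real ` {0..})"
    by (intro connected_continuous_image continuous_intros) auto
  moreover have zero: "0 \<in> complex_of_real ` {0..}"
    by (rule image_eqI[of _ _ 0]) auto
  ultimately have ray: "complex_of_real ` {0..} \<subseteq> W"
    unfolding W_def by (intro connected_component_maximal) (use B(2) C(2) in auto)
  have "eventually (\<lambda>z. B z = C z) (nhds 0)"
    using B(4) C(4) unfolding has_fps_expansion_def by (auto elim: eventually_elim2)
  then obtain N where N: "open N" "0 \<in> N" "\<And>z. z \<in> N \<Longrightarrow> B z = C z"
    unfolding eventually_nhds by blast
  have ne: "N \<inter> W \<noteq> {}" using N(2) ray zero by blast
  have hol: "B holomorphic_on W" "C holomorphic_on W"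
    using B(3) C(3) W(3,4) holomorphic_on_subset by blast+
  have eq: "B z = C z" if "z \<in> W" for z
    by (rule analytic_continuation_open[of "N \<inter> W" W B C]) (use N W ne hol that in auto)
  have "((\<lambda>t. exp (- complex_of_real t) * B (complex_of_real t)) has_integral T) {0..}"
    by (intro has_integral_eq[OF _ C(5)]) (use eq ray in auto)
  with B(5) show ?thesis by (rule has_integral_unique)
qed

text \<open>
  The $n$-th term of the hypergeometric series at $x$ is \<^term>\<open>fps_hypergeo as bs x $ n\<close>.
  When $p > q + 1$ the series diverges for every $x \neq 0$ unless it terminates; its value is
  then its Borel sum. For ${}_2F_0$ off the cut $[0,\infty)$ this is the usual value, given by
  the confluent function $U$ as $(-1/z)^a\,U(a, a-b+1, -1/z)$.
\<close>

definition hypergeometric :: "complex list \<Rightarrow> complex list \<Rightarrow> complex \<Rightarrow> complex" where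
  "hypergeometric as bs x =
     (if summable (\<lambda>n. fps_hypergeo as bs x $ n)
      then \<Sum>n. fps_hypergeo as bs x $ n
      else (THE S. borel_sums (\<lambda>n. fps_hypergeo as bs x $ n) S))"

text \<open>
  Poincar\'e asymptotic expansion, uniformly as $u \to \infty$ in the half-plane
  $\mathrm{Re}\,u > 0$.
\<close>

definition asymptotic_series :: "(complex \<Rightarrow> complex) \<Rightarrow> (nat \<Rightarrow> complex \<Rightarrow> complex) \<Rightarrow> bool" where
  "asymptotic_series F t \<longleftrightarrow>
     (\<forall>N. (\<lambda>u. F u - (\<Sum>n\<le>N. t n u)) \<in> o[inf at_infinity (principal {u. Re u > 0})](t N))"

end

theory Submission
  imports Defs
begin

text \<open>
  Let \<open>g x = exp (- (c * x\<^sup>2))\<close> with \<open>c = \<theta>\<^sup>2\<close>. Expanding \<open>g\<close> in powers of \<open>x\<close> and integrating term by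
  term against \<open>exp (- u * x)\<close> yields the hypergeometric series formally. For \<open>c > 0\<close> this series
  diverges, and the identity is proved in two senses.

  As an equation between the transform and the Borel sum: by the binomial series, the Borel transform is
  \<open>(1 + 4 * c * t / u\<^sup>2) powr (- 1/2)\<close>. The substitution \<open>t = c * x\<^sup>2 + u * x\<close> turns its Laplace
  integral into \<open>u\<close> times the integral of \<open>exp (- (c * x\<^sup>2) - u * x)\<close> along a curve that starts at the
  origin, stays in a horizontal strip of the right half-plane and runs to infinity.
  The integrand is entire and decays on that strip, so the curve may be replaced by the real
  half-line (\<open>gaussian_contour\<close>, which rests on \<open>sqrt_branch_bounds\<close> and \<open>gaussian_contour_shift\<close>).

  As an asymptotic expansion: integrating by parts \<open>2 * N + 2\<close> times (\<open>laplace_expansion\<close>) produces the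
  derivatives of \<open>g\<close> at the origin, which are the coefficients of the series (\<open>gauss_poly_even_zero\<close>),
  and a remainder \<open>u\<close> to the power \<open>- (2 * N + 2)\<close> times the transform of a derivative of \<open>g\<close>. This
  derivative is absolutely integrable, so the estimate is uniform in the whole half-plane
  (\<open>gaussian_remainder\<close>).

  The claims on the error function follow by one more integration by parts, because its derivative
  is the Gaussian with \<open>c = 1\<close> and it vanishes at the origin.
\<close>

section \<open>Integration along a half-line\<close>

lemma absolutely_integrable_exp_bound:
  fixes f :: "real \<Rightarrow> complex"
  assumes "a > 0" "continuous_on {0..} f" "\<And>x. x \<ge> 0 \<Longrightarrow> norm (f x) \<le> C * exp (- a * x)"
  shows "f absolutely_integrable_on {0..}"
proof (rule measurable_bounded_by_integrable_imp_absolutely_integrable)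
  show "f \<in> borel_measurable (lebesgue_on {0..})"
    by (intro continuous_imp_measurable_on_sets_lebesgue assms) auto
  show "(\<lambda>x. C * exp (- a * x)) integrable_on {0..}"
    using integrable_on_exp_minus_to_infinity[OF assms(1)] by (intro integrable_on_mult_right) auto
qed (use assms in auto)

text \<open>
  Needed in this form, with the limit of the primitive as conclusion: for the Gaussian the primitive
  is not explicit, and its limit along the real axis is known only through the integral.
\<close>
lemma primitive_tendsto_integral:
  fixes f F :: "real \<Rightarrow> complex"
  assumes "f absolutely_integrable_on {0..}"
    and "\<And>x. x \<ge> 0 \<Longrightarrow> (F has_vector_derivative f x) (at x within {0..})"
  shows "((\<lambda>R. F R - F 0) \<longlongrightarrow> integral {0..} f) at_top"
proof -
  have "((\<lambda>R. set_lebesgue_integral lebesgue {0..R} f)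
      \<longlongrightarrow> set_lebesgue_integral lebesgue {0..} f) at_top"
    by (intro tendsto_set_lebesgue_integral_at_top assms(1)) auto
  moreover have "set_lebesgue_integral lebesgue {0..} f = integral {0..} f"
    using assms(1) by (simp add: set_lebesgue_integral_eq_integral)
  moreover have "\<forall>\<^sub>F R in at_top. set_lebesgue_integral lebesgue {0..R} f = F R - F 0"
    using eventually_ge_at_top[of 0]
  proof eventually_elim
    case (elim R)
    have "f absolutely_integrable_on {0..R}"
      by (rule set_integrable_subset[OF assms(1)]) auto
    then have "set_lebesgue_integral lebesgue {0..R} f = integral {0..R} f"
      by (simp add: set_lebesgue_integral_eq_integral)
    also have "(f has_integral (F R - F 0)) {0..R}"
      using elim
      by (intro fundamental_theorem_of_calculus)
         (auto intro: has_vector_derivative_within_subset[OF assms(2)])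
    then have "integral {0..R} f = F R - F 0" by (rule integral_unique)
    finally show ?case .
  qed
  ultimately show ?thesis using tendsto_cong by force
qed

lemma has_integral_half_line:
  fixes f F :: "real \<Rightarrow> complex"
  assumes "f absolutely_integrable_on {0..}"
    and "\<And>x. x \<ge> 0 \<Longrightarrow> (F has_vector_derivative f x) (at x within {0..})"
    and "(F \<longlongrightarrow> L) at_top"
  shows "(f has_integral (L - F 0)) {0..}"
proof -
  have "((\<lambda>R. F R - F 0) \<longlongrightarrow> L - F 0) at_top"
    by (intro tendsto_intros assms)
  then have "integral {0..} f = L - F 0"
    using primitive_tendsto_integral[OF assms(1,2)] tendsto_unique trivial_limit_at_top_linorder
    by blast
  moreover have "f integrable_on {0..}"
    using assms(1) by (simp add: set_lebesgue_integral_eq_integral)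
  ultimately show ?thesis using integrable_integral by fastforce
qed

section \<open>The Laplace transform of bounded functions\<close>

lemma laplace_integrand_bounded:
  assumes "Re u > 0" "continuous_on {0..} f" "\<And>x. x \<ge> 0 \<Longrightarrow> \<bar>f x\<bar> \<le> B"
  shows "(\<lambda>x. complex_of_real (f x) * exp (- u * complex_of_real x)) absolutely_integrable_on {0..}"
proof (rule absolutely_integrable_exp_bound[OF assms(1)])
  show "continuous_on {0..} (\<lambda>x. complex_of_real (f x) * exp (- u * complex_of_real x))"
    by (intro continuous_intros assms)
  show "norm (complex_of_real (f x) * exp (- u * complex_of_real x)) \<le> B * exp (- Re u * x)"
    if "x \<ge> 0" for x
    using assms(3)[OF that] by (simp add: norm_mult mult_right_mono)
qed

lemma laplace_exists_bounded:
  assumes "Re u > 0" "continuous_on {0..} f" "\<And>x. x \<ge> 0 \<Longrightarrow> \<bar>f x\<bar> \<le> B"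
  shows "laplace_exists f u"
  using laplace_integrand_bounded[OF assms]
  unfolding laplace_exists_def by (rule set_lebesgue_integral_eq_integral(1))

lemma tendsto_exp_minus_at_top:
  assumes "a > (0::real)"
  shows "((\<lambda>x. exp (- a * x)) \<longlongrightarrow> 0) at_top"
  using assms by (intro filterlim_compose[OF exp_at_bot] filterlim_tendsto_neg_mult_at_bot[where c="-a"] filterlim_ident) auto

text \<open>
  Integration by parts: the primitive \<open>f x * exp (- u * x)\<close> vanishes at infinity, so only its
  value at the origin survives. This is used for the error function and, iterated, for the
  asymptotic expansion of the Gaussian.
\<close>
lemma laplace_deriv:
  assumes u: "Re u > 0"
    and deriv: "\<And>x. x \<ge> 0 \<Longrightarrow> (f has_real_derivative f' x) (at x)"
    and cont: "continuous_on {0..} f'"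
    and bounds: "\<And>x. x \<ge> 0 \<Longrightarrow> \<bar>f x\<bar> \<le> B" "\<And>x. x \<ge> 0 \<Longrightarrow> \<bar>f' x\<bar> \<le> B'"
  shows "laplace f' u = u * laplace f u - complex_of_real (f 0)"
proof -
  define e where "e = (\<lambda>x. exp (- u * complex_of_real x))"
  have contf: "continuous_on {0..} f"
    using deriv by (intro continuous_at_imp_continuous_on) (auto intro: DERIV_isCont)
  have intf: "(\<lambda>x. complex_of_real (f x) * e x) absolutely_integrable_on {0..}"
    unfolding e_def by (rule laplace_integrand_bounded[OF u contf bounds(1)])
  have intf': "(\<lambda>x. complex_of_real (f' x) * e x) absolutely_integrable_on {0..}"
    unfolding e_def by (rule laplace_integrand_bounded[OF u cont bounds(2)])
  have ai: "(\<lambda>x. complex_of_real (f' x) * e x - u * (complex_of_real (f x) * e x))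
      absolutely_integrable_on {0..}"
    by (intro set_integral_diff set_integrable_mult_right intf intf')
  have lim: "((\<lambda>x. complex_of_real (f x) * e x) \<longlongrightarrow> 0) at_top"
  proof (rule Lim_null_comparison)
    show "((\<lambda>x. B * exp (- Re u * x)) \<longlongrightarrow> 0) at_top"
      using tendsto_mult_right_zero[OF tendsto_exp_minus_at_top[OF u]] by simp
    show "\<forall>\<^sub>F x in at_top. norm (complex_of_real (f x) * e x) \<le> B * exp (- Re u * x)"
      using eventually_ge_at_top[of 0]
      by eventually_elim (use bounds(1) in \<open>auto simp: norm_mult e_def mult_right_mono\<close>)
  qed
  have "((\<lambda>x. complex_of_real (f' x) * e x - u * (complex_of_real (f x) * e x))
      has_integral (0 - complex_of_real (f 0) * e 0)) {0..}"
  proof (rule has_integral_half_line[OF ai _ lim])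
    fix x :: real assume "x \<ge> 0"
    have 1: "((\<lambda>x. complex_of_real (f x)) has_vector_derivative complex_of_real (f' x)) (at x within {0..})"
      using deriv[OF \<open>x \<ge> 0\<close>]
      by (intro has_vector_derivative_of_real)
         (auto simp: has_real_derivative_iff_has_vector_derivative intro: has_vector_derivative_at_within)
    have 2: "(e has_vector_derivative (- u * e x)) (at x within {0..})"
      unfolding e_def
      by (rule has_vector_derivative_real_field) (auto intro!: derivative_eq_intros)
    show "((\<lambda>x. complex_of_real (f x) * e x) has_vector_derivative
        (complex_of_real (f' x) * e x - u * (complex_of_real (f x) * e x))) (at x within {0..})"
      using has_vector_derivative_mult[OF 1 2] by (simp add: algebra_simps)
  qed
  moreover have "((\<lambda>x. complex_of_real (f' x) * e x - u * (complex_of_real (f x) * e x))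
      has_integral (laplace f' u - u * laplace f u)) {0..}"
    unfolding laplace_def fun_cong[OF e_def, symmetric]
    by (intro has_integral_diff has_integral_mult_right integrable_integral
        set_lebesgue_integral_eq_integral(1) intf intf')
  ultimately have "0 - complex_of_real (f 0) * e 0 = laplace f' u - u * laplace f u"
    by (rule has_integral_unique)
  moreover have "e 0 = 1" by (simp add: e_def)
  ultimately show ?thesis by (simp add: algebra_simps)
qed

text \<open>
  What matters is that the bound does not depend on \<open>u\<close>. Decay of \<open>f\<close> itself has to provide it,
  as \<open>exp (- u * x)\<close> loses its decay when \<open>u\<close> approaches the imaginary axis.
\<close>
lemma norm_laplace_le:
  assumes u: "Re u > 0" and cont: "continuous_on {0..} f"
    and bound: "\<And>x. x \<ge> 0 \<Longrightarrow> \<bar>f x\<bar> \<le> C * exp (- x)"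
  shows "norm (laplace f u) \<le> C"
proof -
  have nonneg: "C \<ge> 0" using bound[of 0] by simp
  have B: "\<bar>f x\<bar> \<le> C" if "x \<ge> 0" for x
    using bound[OF that] that nonneg mult_left_mono[of "exp (-x)" 1 C] by auto
  have I: "((\<lambda>x. C * exp (- x)) has_integral C) {0..}"
    using has_integral_mult_right[OF has_integral_exp_minus_to_infinity[of 1 0], of C] by simp
  have "norm (laplace f u) \<le> integral {0..} (\<lambda>x. C * exp (- x))"
    unfolding laplace_def
  proof (rule integral_norm_bound_integral)
    show "(\<lambda>x. complex_of_real (f x) * exp (- u * complex_of_real x)) integrable_on {0..}"
      using laplace_exists_bounded[OF u cont B] unfolding laplace_exists_def .
    show "(\<lambda>x. C * exp (- x)) integrable_on {0..}" using I by blast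
    fix x :: real assume x: "x \<in> {0..}"
    then have "exp (- (Re u * x)) \<le> 1" using u by simp
    then have "\<bar>f x\<bar> * exp (- (Re u * x)) \<le> \<bar>f x\<bar>" by (intro mult_left_le) auto
    then show "norm (complex_of_real (f x) * exp (- u * complex_of_real x)) \<le> C * exp (- x)"
      using bound[of x] x by (simp add: norm_mult)
  qed
  also have "\<dots> = C" using I by (rule integral_unique)
  finally show ?thesis .
qed

text \<open>
  The rule for derivatives, solved for the transform of \<open>g k\<close> and iterated. The functions
  \<open>g k\<close> are the successive derivatives of \<open>g 0\<close>.
\<close>
lemma laplace_expansion:
  assumes u: "Re u > 0"
    and deriv: "\<And>k x. x \<ge> 0 \<Longrightarrow> (g k has_real_derivative g (Suc k) x) (at x)"
    and bounds: "\<And>k. \<exists>B. \<forall>x\<ge>0. \<bar>g k x\<bar> \<le> B"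
  shows "laplace (g 0) u = (\<Sum>k<m. complex_of_real (g k 0) / u ^ Suc k) + laplace (g m) u / u ^ m"
proof (induction m)
  case (Suc m)
  have "continuous_on {0..} (g (Suc m))"
    using deriv by (intro continuous_at_imp_continuous_on) (auto intro: DERIV_isCont)
  moreover obtain B B' where "\<And>x. x \<ge> 0 \<Longrightarrow> \<bar>g m x\<bar> \<le> B" "\<And>x. x \<ge> 0 \<Longrightarrow> \<bar>g (Suc m) x\<bar> \<le> B'"
    using bounds[of m] bounds[of "Suc m"] by blast
  ultimately have "laplace (g (Suc m)) u = u * laplace (g m) u - complex_of_real (g m 0)"
    by (intro laplace_deriv[OF u deriv])
  moreover have "u \<noteq> 0" using u by auto
  ultimately have "laplace (g m) u = complex_of_real (g m 0) / u + laplace (g (Suc m)) u / u"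
    by (simp add: field_simps)
  then have "laplace (g m) u / u ^ m = complex_of_real (g m 0) / u ^ Suc m + laplace (g (Suc m)) u / u ^ Suc m"
    by (simp only: add_divide_distrib divide_divide_eq_left power_Suc)
  then show ?case unfolding Suc.IH by (simp only: sum.lessThan_Suc add.assoc)
qed simp

section \<open>Derivatives of the Gaussian\<close>

text \<open>
  The polynomial factor of the \<open>k\<close>-th derivative of the Gaussian \<open>exp (- (c * x\<^sup>2))\<close>; up to scaling
  these are for \<open>c > 0\<close> the Hermite polynomials, defined by their three-term recurrence. For \<open>k = 0\<close> the
  index \<open>k - 1\<close> is truncated, which is harmless because of the factor \<open>k\<close>.
\<close>
fun gauss_poly :: "real \<Rightarrow> nat \<Rightarrow> real \<Rightarrow> real" where
  "gauss_poly c 0 x = 1"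
| "gauss_poly c (Suc k) x = - 2 * c * (x * gauss_poly c k x + real k * gauss_poly c (k - 1) x)"

text \<open>
  The Appell property of Hermite polynomials. It turns the three-term recurrence into
  the product rule for the derivatives of the Gaussian.
\<close>
lemma gauss_poly_deriv:
  "(gauss_poly c k has_real_derivative - 2 * c * real k * gauss_poly c (k - 1) x) (at x)"
proof (induction k rule: less_induct)
  case (less k)
  show ?case
  proof (cases k)
    case 0
    have "gauss_poly c 0 = (\<lambda>x. 1)" by auto
    then show ?thesis using 0 by simp
  next
    case (Suc j)
    have eq: "gauss_poly c k = (\<lambda>x. - 2 * c * (x * gauss_poly c j x + real j * gauss_poly c (j - 1) x))"
      using Suc by auto
    have "x * (- 2 * c * real j * gauss_poly c (j - 1) x)
        + real j * (- 2 * c * real (j - 1) * gauss_poly c (j - 1 - 1) x) = real j * gauss_poly c j x"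
      by (cases j) (auto simp: algebra_simps)
    then obtain A B where IH: "(gauss_poly c j has_real_derivative A) (at x)"
        "(gauss_poly c (j - 1) has_real_derivative B) (at x)"
      and AB: "x * A + real j * B = real j * gauss_poly c j x"
      by (rule that[OF less less, rotated 2]) (use Suc in simp_all)
    have "((\<lambda>x. - 2 * c * (x * gauss_poly c j x + real j * gauss_poly c (j - 1) x)) has_real_derivative
       - 2 * c * (1 * gauss_poly c j x + A * x + real j * B)) (at x)"
      by (intro DERIV_cmult DERIV_add DERIV_mult DERIV_ident IH)
    moreover have "1 * gauss_poly c j x + A * x + real j * B = real k * gauss_poly c j x"
      using AB Suc by (simp add: algebra_simps)
    ultimately show ?thesis unfolding eq by (simp only: Suc diff_Suc_1 mult.assoc)
  qed
qed

lemma gaussian_deriv: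
  "((\<lambda>x. gauss_poly c k x * exp (- (c * x\<^sup>2))) has_real_derivative
    gauss_poly c (Suc k) x * exp (- (c * x\<^sup>2))) (at x)"
  by (rule derivative_eq_intros gauss_poly_deriv refl)+ (simp add: algebra_simps)

text \<open>
  The crude exponential bound is preserved by the recurrence, since multiplication by \<open>x\<close>
  costs at most one factor \<open>exp x\<close>; the Gaussian beats any such bound.
\<close>
lemma gauss_poly_growth: "\<exists>C\<ge>0. \<forall>x\<ge>0. \<bar>gauss_poly c k x\<bar> \<le> C * exp (real k * x)"
proof (induction k rule: less_induct)
  case (less k)
  show ?case
  proof (cases k)
    case 0
    then show ?thesis by (intro exI[of _ 1]) auto
  next
    case (Suc j)
    obtain C where C: "C \<ge> 0" "\<And>x. x \<ge> 0 \<Longrightarrow> \<bar>gauss_poly c j x\<bar> \<le> C * exp (real j * x)"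
      using less[of j] Suc by auto
    obtain D where D: "D \<ge> 0" "\<And>x. x \<ge> 0 \<Longrightarrow> \<bar>gauss_poly c (j-1) x\<bar> \<le> D * exp (real (j-1) * x)"
      using less[of "j-1"] Suc by (auto simp: less_Suc_eq_le)
    have "\<bar>gauss_poly c k x\<bar> \<le> 2 * \<bar>c\<bar> * (C + real j * D) * exp (real k * x)" if x: "x \<ge> 0" for x
    proof -
      have exp_ge: "x \<le> exp x" using exp_ge_add_one_self[of x] by linarith
      have "x * \<bar>gauss_poly c j x\<bar> \<le> exp x * (C * exp (real j * x))"
        by (rule mult_mono[OF exp_ge C(2)[OF x]]) auto
      also have "\<dots> = C * exp (real k * x)" using Suc by (simp add: algebra_simps flip: exp_add)
      finally have 1: "x * \<bar>gauss_poly c j x\<bar> \<le> C * exp (real k * x)" .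
      have "exp (real (j-1) * x) \<le> exp (real k * x)" using x Suc by (simp add: mult_right_mono)
      then have "D * exp (real (j-1) * x) \<le> D * exp (real k * x)" using D(1) by (rule mult_left_mono)
      then have 2: "\<bar>gauss_poly c (j-1) x\<bar> \<le> D * exp (real k * x)" using D(2)[OF x] by linarith
      have "\<bar>x * gauss_poly c j x + real j * gauss_poly c (j-1) x\<bar>
          \<le> x * \<bar>gauss_poly c j x\<bar> + real j * \<bar>gauss_poly c (j-1) x\<bar>"
        using x by (intro order_trans[OF abs_triangle_ineq]) (simp add: abs_mult)
      also have "\<dots> \<le> C * exp (real k * x) + real j * (D * exp (real k * x))"
        using 1 2 by (intro add_mono mult_left_mono) auto
      also have "\<dots> = (C + real j * D) * exp (real k * x)" by (simp add: distrib_right)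
      finally have "2 * \<bar>c\<bar> * \<bar>x * gauss_poly c j x + real j * gauss_poly c (j-1) x\<bar>
          \<le> 2 * \<bar>c\<bar> * ((C + real j * D) * exp (real k * x))"
        by (rule mult_left_mono) auto
      moreover have "\<bar>gauss_poly c k x\<bar> =
          2 * \<bar>c\<bar> * \<bar>x * gauss_poly c j x + real j * gauss_poly c (j-1) x\<bar>"
        by (simp only: Suc gauss_poly.simps abs_mult abs_numeral abs_minus_cancel)
      ultimately show ?thesis by (simp only: mult.assoc)
    qed
    then show ?thesis using C(1) D(1)
      by (intro exI[of _ "2 * \<bar>c\<bar> * (C + real j * D)"]) auto
  qed
qed

lemma gaussian_deriv_decay:
  assumes "c > 0"
  shows "\<exists>C. \<forall>x\<ge>0. \<bar>gauss_poly c k x * exp (- (c * x\<^sup>2))\<bar> \<le> C * exp (- x)"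
proof -
  obtain D where D: "D \<ge> 0" "\<And>x. x \<ge> 0 \<Longrightarrow> \<bar>gauss_poly c k x\<bar> \<le> D * exp (real k * x)"
    using gauss_poly_growth by blast
  define M where "M = (real k + 1)\<^sup>2 / (4 * c)"
  have "\<bar>gauss_poly c k x * exp (- (c * x\<^sup>2))\<bar> \<le> D * exp M * exp (- x)" if x: "x \<ge> 0" for x
  proof -
    \<comment> \<open>Completing the square bounds \<open>(k + 1) * x - c * x\<^sup>2\<close> by its maximum \<open>M\<close>.\<close>
    have "0 \<le> c * (x - (real k + 1) / (2 * c))\<^sup>2" using assms by simp
    also have "\<dots> = c * x\<^sup>2 - (real k + 1) * x + M"
      using assms by (simp add: M_def power2_eq_square field_simps)
    finally have "real k * x + - (c * x\<^sup>2) \<le> M + - x" by (simp add: algebra_simps)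
    then have "exp (real k * x) * exp (- (c * x\<^sup>2)) \<le> exp M * exp (- x)"
      by (simp flip: exp_add)
    then have "D * (exp (real k * x) * exp (- (c * x\<^sup>2))) \<le> D * (exp M * exp (- x))"
      using D(1) by (rule mult_left_mono)
    moreover have "\<bar>gauss_poly c k x * exp (- (c * x\<^sup>2))\<bar> \<le> D * (exp (real k * x) * exp (- (c * x\<^sup>2)))"
      using mult_right_mono[OF D(2)[OF x], of "exp (- (c * x\<^sup>2))"] by (simp add: abs_mult mult.assoc)
    ultimately show ?thesis by linarith
  qed
  then show ?thesis by blast
qed

section \<open>The asymptotic series\<close>

abbreviation (input) term_2F0 :: "complex \<Rightarrow> nat \<Rightarrow> complex" where
  "term_2F0 z n \<equiv> fps_hypergeo [1/2, 1] [] z $ n"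

declare fps_hypergeo_nth [simp del]

text \<open>
  The parameter \<open>1\<close> contributes \<open>fact n\<close>, which cancels against the denominator.
\<close>
lemma hypergeo_2F0_nth:
  "term_2F0 z n = pochhammer (1/2) n * z ^ n"
  by (simp add: fps_hypergeo_nth pochhammer_fact[symmetric])

lemma gauss_poly_odd_zero: "gauss_poly c (Suc (2 * n)) 0 = 0"
  by (induction n) auto

text \<open>
  The even Taylor data of the Gaussian at the origin are exactly the coefficients of
  the hypergeometric series, as both satisfy the same first-order recurrence.
\<close>
lemma gauss_poly_even_zero: "gauss_poly c (2 * n) 0 = pochhammer (1/2) n * (- 4 * c) ^ n"
proof (induction n)
  case (Suc n)
  have "gauss_poly c (2 * Suc n) 0 = - 2 * c * (2 * real n + 1) * gauss_poly c (2 * n) 0"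
    using gauss_poly_odd_zero[of c n] by simp
  then show ?case unfolding Suc.IH pochhammer_Suc power_Suc by (simp add: field_simps)
qed simp

lemma laplace_one:
  assumes "Re u > 0"
  shows "laplace (\<lambda>x. 1) u = 1 / u"
proof -
  have "laplace (\<lambda>x. 0) u = u * laplace (\<lambda>x. 1) u - 1"
    using laplace_deriv[OF assms, of "\<lambda>x. 1" "\<lambda>x. 0" 1 0] by simp
  moreover have "laplace (\<lambda>x. 0) u = 0" by (simp add: laplace_def)
  moreover have "u \<noteq> 0" using assms by auto
  ultimately show ?thesis by (simp add: field_simps)
qed

text \<open>
  The odd derivatives vanish at the origin, so expanding up to order \<open>2 * N + 2\<close> gives \<open>N + 1\<close>
  hypergeometric terms.
\<close>
lemma gaussian_partial_sum:
  fixes s :: complex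
  shows "(\<Sum>k<2 * N + 2. complex_of_real (gauss_poly c k 0) / s ^ Suc k) =
    (\<Sum>n\<le>N. 1 / s * term_2F0 (- (4 * complex_of_real c / s\<^sup>2)) n)"
proof -
  have even: "complex_of_real (gauss_poly c (2 * n) 0) / s ^ Suc (2 * n) =
      1 / s * term_2F0 (- (4 * complex_of_real c / s\<^sup>2)) n" for n
  proof -
    have "(- (4 * complex_of_real c / s\<^sup>2)) ^ n = (- 4 * complex_of_real c) ^ n / s ^ (2 * n)"
      by (simp add: power_mult flip: power_divide)
    then show ?thesis
      unfolding hypergeo_2F0_nth gauss_poly_even_zero
      by (simp add: pochhammer_of_real[symmetric])
  qed
  show ?thesis
  proof (induction N)
    case 0
    show ?case using even[of 0] gauss_poly_odd_zero[of c 0] by (simp add: numeral_2_eq_2)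
  next
    case (Suc N)
    define f where "f = (\<lambda>k. complex_of_real (gauss_poly c k 0) / s ^ Suc k)"
    have "(\<Sum>k<2 * Suc N + 2. f k) = (\<Sum>k<2 * N + 2. f k) + f (2 * Suc N) + f (Suc (2 * Suc N))"
      by simp
    also have "f (Suc (2 * Suc N)) = 0"
      unfolding f_def gauss_poly_odd_zero by simp
    also have "f (2 * Suc N) = 1 / s * term_2F0 (- (4 * complex_of_real c / s\<^sup>2)) (Suc N)"
      unfolding f_def by (rule even)
    finally show ?case using Suc.IH unfolding f_def by (simp only: add_0_right sum.atMost_Suc)
  qed
qed

lemma asymptotic_seriesI:
  assumes "\<And>N e. e > 0 \<Longrightarrow> \<exists>b. \<forall>s. Re s > 0 \<longrightarrow> norm s \<ge> b \<longrightarrow>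
    norm (F s - (\<Sum>n\<le>N. t n s)) \<le> e * norm (t N s)"
  shows "asymptotic_series F t"
  unfolding asymptotic_series_def
proof (intro allI landau_o.smallI)
  fix N and e :: real assume "e > 0"
  then show "\<forall>\<^sub>F s in inf at_infinity (principal {u. Re u > 0}).
      norm (F s - (\<Sum>n\<le>N. t n s)) \<le> e * norm (t N s)"
    unfolding eventually_inf_principal eventually_at_infinity using assms[of e N] by blast
qed

text \<open>
  Dividing by \<open>s\<close> scales the remainder and the comparison term alike; this carries the expansion
  of the Gaussian over to the error function.
\<close>
lemma asymptotic_series_divide:
  assumes "asymptotic_series F t" "\<And>s. Re s > 0 \<Longrightarrow> G s = 1 / s * F s"
    "\<And>n s. Re s > 0 \<Longrightarrow> r n s = 1 / s * t n s"
  shows "asymptotic_series G r"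
proof (rule asymptotic_seriesI)
  fix N and e :: real assume e: "e > 0"
  have "\<forall>\<^sub>F s in inf at_infinity (principal {u. Re u > 0}).
      norm (F s - (\<Sum>n\<le>N. t n s)) \<le> e * norm (t N s)"
    using assms(1) e unfolding asymptotic_series_def by (blast dest: landau_o.smallD)
  then obtain b where b: "\<And>s. norm s \<ge> b \<Longrightarrow> Re s > 0 \<Longrightarrow>
      norm (F s - (\<Sum>n\<le>N. t n s)) \<le> e * norm (t N s)"
    unfolding eventually_inf_principal eventually_at_infinity by auto
  have "norm (G s - (\<Sum>n\<le>N. r n s)) \<le> e * norm (r N s)" if s: "Re s > 0" "norm s \<ge> b" for s
  proof -
    have "G s - (\<Sum>n\<le>N. r n s) = 1 / s * (F s - (\<Sum>n\<le>N. t n s))"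
      using assms(2,3)[OF s(1)] by (simp add: right_diff_distrib sum_distrib_left diff_divide_distrib flip: sum_divide_distrib)
    then have "norm (G s - (\<Sum>n\<le>N. r n s)) = norm (1 / s) * norm (F s - (\<Sum>n\<le>N. t n s))"
      by (simp only: norm_mult)
    also have "\<dots> \<le> norm (1 / s) * (e * norm (t N s))"
      using b[OF s(2,1)] by (rule mult_left_mono) simp
    also have "\<dots> = e * norm (r N s)" using assms(3)[OF s(1)] by (simp add: norm_divide)
    finally show ?thesis .
  qed
  then show "\<exists>b. \<forall>s. Re s > 0 \<longrightarrow> norm s \<ge> b \<longrightarrow> norm (G s - (\<Sum>n\<le>N. r n s)) \<le> e * norm (r N s)"
    by blast
qed

text \<open>
  The expansion is pushed to order \<open>2 * N + 2\<close>, one beyond the last nonzero term, so that the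
  remainder gains a full power of \<open>s\<close> over the \<open>N\<close>-th term.
\<close>
lemma gaussian_remainder:
  assumes c: "c > 0"
  shows "\<exists>C. \<forall>s. Re s > 0 \<longrightarrow> norm (laplace (\<lambda>x. exp (- (c * x\<^sup>2))) s -
     (\<Sum>n\<le>N. 1 / s * term_2F0 (- (4 * complex_of_real c / s\<^sup>2)) n))
     \<le> C / norm s ^ (2 * N + 2)"
proof -
  define g where "g = (\<lambda>k x. gauss_poly c k x * exp (- (c * x\<^sup>2)))"
  have deriv: "(g k has_real_derivative g (Suc k) x) (at x)" for k x
    unfolding g_def by (rule gaussian_deriv)
  have decay: "\<exists>C. \<forall>x\<ge>0. \<bar>g k x\<bar> \<le> C * exp (- x)" for k
    unfolding g_def by (rule gaussian_deriv_decay[OF c])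
  have bounded: "\<exists>B. \<forall>x\<ge>0. \<bar>g k x\<bar> \<le> B" for k
  proof -
    obtain C where C: "\<And>x. x \<ge> 0 \<Longrightarrow> \<bar>g k x\<bar> \<le> C * exp (- x)" using decay by blast
    have "C \<ge> 0" using C[of 0] by simp
    then have "\<bar>g k x\<bar> \<le> C" if "x \<ge> 0" for x
      using C[OF that] that mult_left_mono[of "exp (-x)" 1 C] by auto
    then show ?thesis by blast
  qed
  obtain C where C: "\<And>x. x \<ge> 0 \<Longrightarrow> \<bar>g (2 * N + 2) x\<bar> \<le> C * exp (- x)" using decay by blast
  have cont: "continuous_on {0..} (g k)" for k
    using deriv by (intro continuous_at_imp_continuous_on) (auto intro: DERIV_isCont)
  have "norm (laplace (\<lambda>x. exp (- (c * x\<^sup>2))) s -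
     (\<Sum>n\<le>N. 1 / s * term_2F0 (- (4 * complex_of_real c / s\<^sup>2)) n))
     \<le> C / norm s ^ (2 * N + 2)" if s: "Re s > 0" for s
  proof -
    have g_eqs: "g 0 = (\<lambda>x. exp (- (c * x\<^sup>2)))" "\<And>k. g k 0 = gauss_poly c k 0" by (auto simp: g_def)
    have "laplace (\<lambda>x. exp (- (c * x\<^sup>2))) s -
       (\<Sum>n\<le>N. 1 / s * term_2F0 (- (4 * complex_of_real c / s\<^sup>2)) n)
       = laplace (g (2 * N + 2)) s / s ^ (2 * N + 2)"
      using laplace_expansion[where g = g, OF s deriv bounded, of "2 * N + 2"]
      unfolding g_eqs gaussian_partial_sum by (simp only: add_diff_cancel_left')
    then show ?thesis
      using divide_right_mono[OF norm_laplace_le[OF s cont C], of "norm s ^ (2 * N + 2)"]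
      by (simp only: norm_divide norm_power zero_le_power norm_ge_zero)
  qed
  then show ?thesis by blast
qed

text \<open>
  For \<open>c = 0\<close> all terms with \<open>n > 0\<close> vanish, and the expansion has to be exact; for \<open>c > 0\<close> the
  remainder estimate is compared with the nonzero \<open>N\<close>-th term.
\<close>
lemma gaussian_asymptotic_series:
  assumes "c \<ge> 0"
  shows "asymptotic_series (laplace (\<lambda>x. exp (- (c * x\<^sup>2))))
    (\<lambda>n s. 1 / s * term_2F0 (- (4 * complex_of_real c / s\<^sup>2)) n)"
proof (cases "c = 0")
  case True
  have "(\<Sum>n\<le>N. 1 / s * term_2F0 0 n) = 1 / s" for N and s :: complex
    by (simp add: hypergeo_2F0_nth power_0_left if_distrib sum.delta cong: if_cong)
  then show ?thesis using True laplace_one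
    by (intro asymptotic_seriesI) (auto)
next
  case False
  with assms have c: "c > 0" by simp
  show ?thesis
  proof (rule asymptotic_seriesI)
    fix N and e :: real assume e: "e > 0"
    obtain C where C: "\<And>s. Re s > 0 \<Longrightarrow> norm (laplace (\<lambda>x. exp (- (c * x\<^sup>2))) s -
       (\<Sum>n\<le>N. 1 / s * term_2F0 (- (4 * complex_of_real c / s\<^sup>2)) n))
       \<le> C / norm s ^ (2 * N + 2)"
      using gaussian_remainder[OF c] by blast
    define K where "K = pochhammer (1/2) N * (4 * c) ^ N"
    have K: "K > 0" using c by (auto simp: K_def intro!: mult_pos_pos pochhammer_pos)
    have "C / norm s ^ (2 * N + 2) \<le>
        e * norm (1 / s * term_2F0 (- (4 * complex_of_real c / s\<^sup>2)) N)"
      if s: "Re s > 0" "norm s \<ge> C / (e * K)" for s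
    proof -
      have s0: "norm s > 0" using s by auto
      have "norm (pochhammer (1/2) N :: complex) = pochhammer (1/2) N"
        using pochhammer_of_real[of "1/2" N, where ?'a = complex] pochhammer_pos[of "1/2 :: real" N]
        by (simp add: norm_of_real)
      then have "norm (1 / s * term_2F0 (- (4 * complex_of_real c / s\<^sup>2)) N)
          = K / norm s ^ (2 * N + 1)"
        unfolding hypergeo_2F0_nth using c
        by (simp add: norm_mult norm_divide norm_power K_def power_divide power_mult)
      moreover have "C \<le> e * K * norm s"
        using s(2) e K by (simp add: field_simps)
      then have "C / norm s ^ (2 * N + 2) \<le> e * K * norm s / norm s ^ (2 * N + 2)"
        by (rule divide_right_mono) simp
      moreover have "e * K * norm s / norm s ^ (2 * N + 2) = e * (K / norm s ^ (2 * N + 1))"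
        using s0 by simp
      ultimately show ?thesis by simp
    qed
    then show "\<exists>b. \<forall>s. Re s > 0 \<longrightarrow> norm s \<ge> b \<longrightarrow> norm (laplace (\<lambda>x. exp (- (c * x\<^sup>2))) s -
       (\<Sum>n\<le>N. 1 / s * term_2F0 (- (4 * complex_of_real c / s\<^sup>2)) n))
       \<le> e * norm (1 / s * term_2F0 (- (4 * complex_of_real c / s\<^sup>2)) N)"
      using C order.trans by blast
  qed
qed

section \<open>The Borel sum\<close>

text \<open>
  Consecutive terms have ratio \<open>z * (1/2 + n)\<close>, whose modulus is eventually at least 1, so the
  terms do not tend to zero. Hence the value of the series is its Borel sum.
\<close>
lemma hypergeo_2F0_not_summable:
  fixes z :: complex
  assumes z: "z \<noteq> 0"
  shows "\<not> summable (\<lambda>n. term_2F0 z n)"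
proof
  define a where "a = (\<lambda>n. pochhammer (1/2) n * z ^ n)"
  assume "summable (\<lambda>n. term_2F0 z n)"
  then have lim: "(\<lambda>n. norm (a n)) \<longlonglongrightarrow> 0"
    unfolding hypergeo_2F0_nth a_def by (intro tendsto_norm_zero summable_LIMSEQ_zero)
  obtain M where M: "real M \<ge> 1 / norm z" using real_arch_simple by blast
  have grow: "norm (a (M + k)) \<ge> norm (a M)" for k
  proof (induction k)
    case (Suc k)
    have "norm z > 0" using z by simp
    then have "1 \<le> norm z * real M" using M by (simp add: field_simps)
    also have "\<dots> \<le> norm z * norm (1 / 2 + of_nat (M + k) :: complex)"
      using complex_Re_le_cmod[of "1 / 2 + of_nat (M + k)"] by (intro mult_left_mono) auto
    finally have "norm (a (M + k)) * 1 \<le> norm (a (M + k)) * (norm z * norm (1 / 2 + of_nat (M + k) :: complex))"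
      by (rule mult_left_mono) simp
    also have "\<dots> = norm (a (M + Suc k))"
      by (simp add: a_def pochhammer_rec' norm_mult)
    finally show ?case using Suc by simp
  qed simp
  have "pochhammer (1/2) M \<noteq> (0 :: complex)"
    using pochhammer_of_real[of "1/2" M, where ?'a = complex] pochhammer_pos[of "1/2 :: real" M]
    by auto
  then have "norm (a M) > 0" using z by (simp add: a_def)
  moreover have "norm (a M) \<le> 0"
    using LIMSEQ_le_const[OF LIMSEQ_ignore_initial_segment[OF lim, of M]] grow
    by (metis add.commute)
  ultimately show False by simp
qed

lemma one_minus_mult_not_nonpos:
  assumes "z \<notin> \<real>\<^sub>\<ge>\<^sub>0" "t \<ge> 0"
  shows "1 - z * complex_of_real t \<notin> \<real>\<^sub>\<le>\<^sub>0"
proof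
  assume "1 - z * complex_of_real t \<in> \<real>\<^sub>\<le>\<^sub>0"
  then have *: "1 \<le> Re z * t" "Im z * t = 0" by (auto simp: complex_nonpos_Reals_iff)
  then have "t \<noteq> 0" by auto
  then have "Im z = 0" using * by simp
  moreover have "Re z * t > 0" using * by linarith
  then have "Re z > 0" using assms(2) by (simp add: zero_less_mult_iff)
  ultimately show False using assms(1) by (simp add: complex_nonneg_Reals_iff)
qed

text \<open>
  The binomial series: \<open>(1 - z * t) powr (- 1/2)\<close> is the Borel transform of the hypergeometric series.
\<close>
lemma has_fps_expansion_inverse_sqrt:
  fixes z :: complex
  shows "(\<lambda>t. (1 - z * t) powr (- 1/2)) has_fps_expansion Abs_fps (\<lambda>n. pochhammer (1/2) n * z ^ n / fact n)"
proof -
  have "((\<lambda>x. (1 + x) powr (- 1/2)) \<circ> (\<lambda>t. - z * t)) has_fps_expansion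
      fps_compose (fps_binomial (- 1/2)) (fps_const (- z) * fps_X)"
    by (intro has_fps_expansion_compose has_fps_expansion_binomial_complex fps_expansion_intros) simp
  moreover have "(- z) ^ n * ((- 1/2) gchoose n) = pochhammer (1/2) n * z ^ n / fact n" for n
  proof -
    have "(- z) ^ n * ((- 1/2) gchoose n) =
        ((- 1) ^ n * (- 1) ^ n) * (z ^ n * (pochhammer (1/2) n / fact n))"
      unfolding gbinomial_pochhammer power_minus[of z] by (simp only: minus_divide_left minus_minus mult_ac times_divide_eq_right)
    also have "(- 1) ^ n * (- 1) ^ n = (1 :: complex)" by (simp flip: power_mult_distrib)
    finally show ?thesis by (simp add: mult.commute)
  qed
  then have "fps_compose (fps_binomial (- 1/2)) (fps_const (- z) * fps_X) =
      Abs_fps (\<lambda>n. pochhammer (1/2) n * z ^ n / fact n)"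
    by (simp only: fps_compose_linear fps_binomial_nth)
  ultimately show ?thesis by (simp add: o_def)
qed

text \<open>
  The principal branch of the Borel transform is holomorphic on the plane slit along the
  ray from \<open>1 / z\<close> to infinity. For \<open>z\<close> off the nonnegative reals this ray
  misses the path of integration.
\<close>
lemma borel_sums_2F0:
  assumes z: "z \<notin> \<real>\<^sub>\<ge>\<^sub>0"
    and int: "((\<lambda>t. exp (- complex_of_real t) * (1 - z * complex_of_real t) powr (- 1/2)) has_integral S) {0..}"
  shows "borel_sums (\<lambda>n. term_2F0 z n) S"
  unfolding borel_sums_def hypergeo_2F0_nth
proof (intro exI conjI)
  define U where "U = (\<lambda>t. 1 - z * t) -` (- \<real>\<^sub>\<le>\<^sub>0)"
  have z0: "z \<noteq> 0" using z by auto
  show "open U" unfolding U_def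
    by (intro continuous_open_vimage open_Compl closed_nonpos_Reals_complex continuous_intros)
  \<comment> \<open>\<open>U\<close> is an affine image of the slit plane, which is star-shaped.\<close>
  have "(- \<real>\<^sub>\<le>\<^sub>0 :: complex set) = - (complex_of_real ` {..0})"
    by (auto simp: nonpos_Reals_def)
  then have "connected (- \<real>\<^sub>\<le>\<^sub>0 :: complex set)"
    using starlike_slotted_complex_plane_left[of 0] starlike_imp_connected by metis
  then have "connected ((\<lambda>y. (1 - y) / z) ` (- \<real>\<^sub>\<le>\<^sub>0))"
    using z0 by (intro connected_continuous_image continuous_intros) auto
  also have "(\<lambda>y. (1 - y) / z) ` (- \<real>\<^sub>\<le>\<^sub>0) = U"
  proof (intro equalityI subsetI)
    fix t assume "t \<in> U"
    then show "t \<in> (\<lambda>y. (1 - y) / z) ` (- \<real>\<^sub>\<le>\<^sub>0)"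
      using z0 by (intro image_eqI[of _ _ "1 - z * t"]) (auto simp: U_def)
  qed (use z0 in \<open>auto simp: U_def\<close>)
  finally show "connected U" .
  show "complex_of_real ` {0..} \<subseteq> U"
    using one_minus_mult_not_nonpos[OF z] by (auto simp: U_def)
  show "(\<lambda>t. (1 - z * t) powr (- 1/2)) holomorphic_on U"
    by (intro holomorphic_intros) (auto simp: U_def)
  show "(\<lambda>t. (1 - z * t) powr (- 1/2)) has_fps_expansion
      Abs_fps (\<lambda>n. pochhammer (1/2) n * z ^ n / fact n)"
    by (rule has_fps_expansion_inverse_sqrt)
qed (rule int)

lemma hypergeometric_2F0_eq:
  assumes z: "z \<notin> \<real>\<^sub>\<ge>\<^sub>0"
    and int: "((\<lambda>t. exp (- complex_of_real t) * (1 - z * complex_of_real t) powr (- 1/2)) has_integral S) {0..}"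
  shows "hypergeometric [1/2, 1] [] z = S"
proof -
  have "z \<noteq> 0" using z by auto
  then have "hypergeometric [1/2, 1] [] z = (THE S. borel_sums (\<lambda>n. term_2F0 z n) S)"
    unfolding hypergeometric_def using hypergeo_2F0_not_summable by simp
  also have "\<dots> = S"
    using borel_sums_2F0[OF z int] by (intro the_equality) (auto intro: borel_sums_unique)
  finally show ?thesis .
qed

section \<open>Deforming the path of the Gaussian integral\<close>

text \<open>
  Adding \<open>r \<ge> 0\<close> to \<open>u\<^sup>2\<close> turns its argument towards the positive axis, so the square root of
  \<open>u\<^sup>2 + r\<close> in the right half-plane lies on the branch of a hyperbola \<open>Re w * Im w = const\<close> through
  \<open>u\<close>, further right and closer to the real axis than \<open>u\<close>. The lemma also says that \<open>u * v\<close> is this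
  square root and not its negative, where \<open>v\<close> is a root of \<open>1 + r / u\<^sup>2\<close> in the right half-plane.
\<close>
lemma sqrt_branch_bounds:
  assumes u: "Re u > 0" and v: "Re v > 0" and r: "r \<ge> 0"
    and sq: "(u * v)\<^sup>2 = u\<^sup>2 + complex_of_real r"
  shows "Re (u * v) \<ge> Re u" "\<bar>Im (u * v)\<bar> \<le> \<bar>Im u\<bar>"
proof -
  define w where "w = u * v"
  have re: "(Re w)\<^sup>2 - (Im w)\<^sup>2 = (Re u)\<^sup>2 - (Im u)\<^sup>2 + r"
    using arg_cong[OF sq, of Re] by (simp add: w_def[symmetric] Re_power2)
  have im: "Re w * Im w = Re u * Im u"
    using arg_cong[OF sq, of Im] by (simp add: w_def[symmetric] Im_power2)
  have pos: "Re w > 0"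
  proof (rule ccontr)
    \<comment> \<open>Otherwise \<open>w\<close> points away from \<open>u\<close>, contradicting that \<open>Re (w * cnj u)\<close> is a
      positive multiple of \<open>Re v\<close>.\<close>
    assume neg: "\<not> Re w > 0"
    have "Im w * Im u \<le> 0"
    proof (cases "Re w = 0")
      case True
      then show ?thesis using im u by auto
    next
      case False
      have "Re w * (Im w * Im u) = Re u * (Im u)\<^sup>2"
        using im by (metis mult.assoc power2_eq_square)
      also have "\<dots> \<ge> 0" using u by simp
      finally show ?thesis using neg False by (simp add: zero_le_mult_iff)
    qed
    moreover have "Re w * Re u \<le> 0" using neg u by (simp add: mult_nonpos_nonneg)
    moreover have "Re w * Re u + Im w * Im u = ((Re u)\<^sup>2 + (Im u)\<^sup>2) * Re v"
      by (simp add: w_def algebra_simps power2_eq_square)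
    moreover have "((Re u)\<^sup>2 + (Im u)\<^sup>2) * Re v > 0"
      using u v by (intro mult_pos_pos add_pos_nonneg) auto
    ultimately show False by linarith
  qed
  have abs: "Re w * \<bar>Im w\<bar> = Re u * \<bar>Im u\<bar>"
    using arg_cong[OF im, of abs] pos u by (simp add: abs_mult)
  have ge: "Re w \<ge> Re u"
  proof (rule ccontr)
    assume less: "\<not> Re w \<ge> Re u"
    have "\<bar>Im w\<bar> \<ge> \<bar>Im u\<bar>"
    proof (rule ccontr)
      assume "\<not> \<bar>Im w\<bar> \<ge> \<bar>Im u\<bar>"
      then have "Re w * \<bar>Im w\<bar> < Re u * \<bar>Im u\<bar>"
        using less pos by (intro mult_strict_mono') auto
      then show False using abs by simp
    qed
    then have "(Im w)\<^sup>2 \<ge> (Im u)\<^sup>2" by (simp add: abs_le_square_iff)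
    moreover have "(Re w)\<^sup>2 < (Re u)\<^sup>2" using less pos by (intro power_strict_mono) auto
    ultimately show False using re r by linarith
  qed
  have "\<bar>Im w\<bar> \<le> \<bar>Im u\<bar>"
  proof (rule ccontr)
    assume "\<not> ?thesis"
    then have "Re u * \<bar>Im u\<bar> < Re w * \<bar>Im w\<bar>"
      using ge u by (intro mult_le_less_imp_less) auto
    then show False using abs by simp
  qed
  with ge show "Re (u * v) \<ge> Re u" "\<bar>Im (u * v)\<bar> \<le> \<bar>Im u\<bar>" by (auto simp: w_def)
qed

lemma minus_divide_square_not_nonneg:
  assumes "c > 0" "Re u > 0"
  shows "- (4 * complex_of_real c / u\<^sup>2) \<notin> \<real>\<^sub>\<ge>\<^sub>0"
proof
  assume "- (4 * complex_of_real c / u\<^sup>2) \<in> \<real>\<^sub>\<ge>\<^sub>0"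
  then obtain r where r: "- (4 * complex_of_real c / u\<^sup>2) = complex_of_real r" "r \<ge> 0"
    by (auto simp: nonneg_Reals_def)
  have "u \<noteq> 0" using assms by auto
  then have "complex_of_real (- 4 * c) = complex_of_real r * u\<^sup>2"
    by (simp add: r(1)[symmetric])
  then have re: "- 4 * c = r * ((Re u)\<^sup>2 - (Im u)\<^sup>2)" and im: "0 = r * (Re u * Im u)"
    by (auto simp: complex_eq_iff Re_power2 Im_power2)
  have "r \<noteq> 0" using re assms by auto
  then have "Im u = 0" using im assms by auto
  then have "- 4 * c \<ge> 0" unfolding re using r by simp
  then show False using assms by simp
qed

text \<open>
  The integral of the Gaussian over the vertical segment from \<open>Re x\<close> to \<open>x\<close>. On a strip of bounded
  height it tends to zero as \<open>Re x\<close> grows, so the path may end anywhere in the strip.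
\<close>
lemma gaussian_contour_shift:
  fixes F :: "complex \<Rightarrow> complex"
  assumes c: "c \<ge> 0" and a: "Re x \<ge> 0" and b: "\<bar>Im x\<bar> \<le> b"
    and F: "\<And>z. (F has_field_derivative exp (- (complex_of_real c * z\<^sup>2) - u * z)) (at z)"
  shows "norm (F x - F (complex_of_real (Re x))) \<le> b * exp (c * b\<^sup>2 + \<bar>Im u\<bar> * b) * exp (- Re u * Re x)"
proof -
  have "norm (F x - F (complex_of_real (Re x))) \<le>
      (exp (c * b\<^sup>2 + \<bar>Im u\<bar> * b) * exp (- Re u * Re x)) * norm (x - complex_of_real (Re x))"
  proof (rule field_differentiable_bound)
    fix z assume "z \<in> closed_segment x (complex_of_real (Re x))"
    then have z: "Re z = Re x" "\<bar>Im z\<bar> \<le> b"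
      using b by (auto simp: closed_segment_same_Re closed_segment_eq_real_ivl split: if_splits)
    have "(Im z)\<^sup>2 \<le> b\<^sup>2" using z(2) by (metis abs_ge_zero power2_abs power_mono)
    then have "c * (Im z)\<^sup>2 \<le> c * b\<^sup>2" using c by (rule mult_left_mono)
    moreover have "Im u * Im z \<le> \<bar>Im u\<bar> * b"
      using mult_left_mono[OF z(2), of "\<bar>Im u\<bar>"] abs_ge_self[of "Im u * Im z"] by (simp add: abs_mult)
    moreover have "c * (Re z)\<^sup>2 \<ge> 0" using c by simp
    ultimately have "Re (- (complex_of_real c * z\<^sup>2) - u * z) \<le> (c * b\<^sup>2 + \<bar>Im u\<bar> * b) + - Re u * Re x"
      using z(1) by (simp add: Re_power2 algebra_simps)
    then show "norm (exp (- (complex_of_real c * z\<^sup>2) - u * z)) \<le>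
        exp (c * b\<^sup>2 + \<bar>Im u\<bar> * b) * exp (- Re u * Re x)"
      by (simp only: norm_exp_eq_Re exp_add[symmetric] exp_le_cancel_iff)
  qed (auto intro: has_field_derivative_at_within F)
  also have "x - complex_of_real (Re x) = \<i> * complex_of_real (Im x)"
    by (simp add: complex_eq_iff)
  also have "norm (\<i> * complex_of_real (Im x)) \<le> b" using b by (simp add: norm_mult)
  finally show ?thesis by (simp add: mult_ac mult_left_mono)
qed

text \<open>
  The substitution \<open>t = c * x\<^sup>2 + u * x\<close> makes the Gaussian integrand equal to \<open>exp (- t)\<close> and \<open>dx\<close> equal to
  \<open>dt\<close> divided by a square root of \<open>u\<^sup>2 + 4 * c * t\<close>. For non-real \<open>u\<close> the inverse image \<open>X\<close> of the half-line
  \<open>t \<ge> 0\<close> is a curve in the complex plane instead of the real half-line. Both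
  paths start at the origin, and the branch bounds keep \<open>X\<close> in a horizontal strip with \<open>Re (X t)\<close>
  tending to infinity. As the integrand has an entire primitive \<open>F\<close>, the two integrals agree.
\<close>
lemma gaussian_contour:
  assumes c: "c > 0" and u: "Re u > 0" and z: "z = - (4 * complex_of_real c / u\<^sup>2)"
  shows "((\<lambda>t. exp (- complex_of_real t) * (1 - z * complex_of_real t) powr (- 1/2))
    has_integral (u * laplace (\<lambda>x. exp (- (c * x\<^sup>2))) u)) {0..}"
proof -
  define v where "v = (\<lambda>t. csqrt (1 - z * complex_of_real t))"
  define X where "X = (\<lambda>t. (u * v t - u) / (2 * complex_of_real c))"
  define f where "f = (\<lambda>x. exp (- (complex_of_real c * x\<^sup>2) - u * x))"
  have u0: "u \<noteq> 0" using u by auto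
  have slit: "1 - z * complex_of_real t \<notin> \<real>\<^sub>\<le>\<^sub>0" if "t \<ge> 0" for t
    using one_minus_mult_not_nonpos minus_divide_square_not_nonneg[OF c u] z that by blast
  have v_pos: "Re (v t) > 0" if "t \<ge> 0" for t
  proof -
    have "Re (v t) \<ge> 0" unfolding v_def by (rule Re_csqrt)
    moreover have "Re (v t) \<noteq> 0"
    proof
      assume "Re (v t) = 0"
      then have "(v t)\<^sup>2 \<in> \<real>\<^sub>\<le>\<^sub>0" by (simp add: complex_nonpos_Reals_iff Re_power2 Im_power2)
      then show False using slit[OF that] by (simp add: v_def)
    qed
    ultimately show ?thesis by simp
  qed
  have sq: "(u * v t)\<^sup>2 = u\<^sup>2 + complex_of_real (4 * c * t)" for t
    using u0 by (simp add: power_mult_distrib v_def z algebra_simps)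
  note bounds = sqrt_branch_bounds[OF u v_pos _ sq]
  have bds: "Re (u * v t) \<ge> Re u" "\<bar>Im (u * v t)\<bar> \<le> \<bar>Im u\<bar>" if "t \<ge> 0" for t
    using bounds[OF that] c that by auto
  have v0: "v t \<noteq> 0" if "t \<ge> 0" for t using v_pos[OF that] by auto
  have integrand: "exp (- complex_of_real t) * (1 - z * complex_of_real t) powr (- 1/2) =
      exp (- complex_of_real t) / v t" if "t \<ge> 0" for t
  proof -
    have "1 - z * complex_of_real t \<noteq> 0" using slit[OF that] by auto
    then have "v t = (1 - z * complex_of_real t) powr (1/2)"
      by (simp add: v_def csqrt_conv_powr)
    moreover have "(- 1/2 :: complex) = - (1/2)" by simp
    ultimately show ?thesis
      by (simp only: powr_minus divide_inverse[of "exp _"])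
  qed
  have v_lower: "norm (v t) \<ge> Re u / norm u" if "t \<ge> 0" for t
  proof -
    have "Re u \<le> norm (u * v t)" using bds(1)[OF that] complex_Re_le_cmod order.trans by blast
    then show ?thesis using u0 by (simp add: norm_mult field_simps)
  qed
  have cont: "continuous_on {0..} v"
    unfolding v_def using slit
    by (intro continuous_at_imp_continuous_on ballI isCont_o2[OF _ continuous_at_csqrt] continuous_intros) auto
  have ai: "(\<lambda>t. exp (- complex_of_real t) / v t) absolutely_integrable_on {0..}"
  proof (rule absolutely_integrable_exp_bound[of 1 _ "norm u / Re u"])
    show "continuous_on {0..} (\<lambda>t. exp (- complex_of_real t) / v t)"
      by (intro continuous_intros cont) (use v0 in auto)
    fix t :: real assume t: "t \<ge> 0"
    have "Re u / norm u > 0" using u u0 by simp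
    then have "exp (- t) / norm (v t) \<le> exp (- t) / (Re u / norm u)"
      using v_lower[OF t] by (intro divide_left_mono mult_pos_pos) auto
    then show "norm (exp (- complex_of_real t) / v t) \<le> norm u / Re u * exp (- 1 * t)"
      by (simp add: norm_divide mult_ac)
  qed simp
  obtain F where F: "\<And>x. (F has_field_derivative f x) (at x)"
  proof -
    have "f holomorphic_on UNIV" unfolding f_def by (intro holomorphic_intros)
    then obtain g where "\<And>x. x \<in> UNIV \<Longrightarrow> (g has_field_derivative f x) (at x within UNIV)"
      using holomorphic_convex_primitive'[of UNIV f] by auto
    then show ?thesis using that by auto
  qed
  have lap: "((\<lambda>R. F (complex_of_real R) - F 0) \<longlongrightarrow> laplace (\<lambda>x. exp (- (c * x\<^sup>2))) u) at_top"
  proof -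
    have eq: "complex_of_real (exp (- (c * x\<^sup>2))) * exp (- u * complex_of_real x) = f (complex_of_real x)" for x
      by (simp add: f_def exp_diff exp_minus exp_of_real[symmetric] field_simps)
    have "(\<lambda>x. complex_of_real (exp (- (c * x\<^sup>2))) * exp (- u * complex_of_real x))
        absolutely_integrable_on {0..}"
      using c by (intro laplace_integrand_bounded[where B = 1] u continuous_intros) auto
    then have "(\<lambda>x. f (complex_of_real x)) absolutely_integrable_on {0..}" by (simp only: eq)
    moreover have "((\<lambda>x. F (complex_of_real x)) has_vector_derivative f (complex_of_real x)) (at x within {0..})" for x
      by (rule has_vector_derivative_real_field[OF F])
    ultimately have "((\<lambda>R. F (complex_of_real R) - F (complex_of_real 0)) \<longlongrightarrow>
        integral {0..} (\<lambda>x. f (complex_of_real x))) at_top"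
      by (rule primitive_tendsto_integral)
    then show ?thesis by (simp add: laplace_def eq[simplified])
  qed
  have ReX: "Re (X t) = (Re (u * v t) - Re u) / (2 * c)" "Im (X t) = (Im (u * v t) - Im u) / (2 * c)" for t
    by (simp_all add: X_def Re_divide_of_real[of _ "2 * c", simplified] Im_divide_of_real[of _ "2 * c", simplified])
  have ReX_top: "filterlim (\<lambda>t. Re (X t)) at_top at_top"
  proof (rule filterlim_at_top_mono)
    have "filterlim (\<lambda>t. Re (u\<^sup>2) + 4 * c * t) at_top at_top"
      using c by (intro filterlim_tendsto_add_at_top[where c = "Re (u\<^sup>2)"] filterlim_tendsto_pos_mult_at_top[where c = "4 * c"] filterlim_ident) auto
    then have "filterlim (\<lambda>t. sqrt (Re (u\<^sup>2) + 4 * c * t)) at_top at_top"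
      by (rule filterlim_compose[OF sqrt_at_top])
    then have "filterlim (\<lambda>t. - Re u + sqrt (Re (u\<^sup>2) + 4 * c * t)) at_top at_top"
      by (rule filterlim_tendsto_add_at_top[OF tendsto_const])
    then have "filterlim (\<lambda>t. 1 / (2 * c) * (- Re u + sqrt (Re (u\<^sup>2) + 4 * c * t))) at_top at_top"
      using c by (intro filterlim_tendsto_pos_mult_at_top[where c = "1 / (2 * c)"]) auto
    then show "filterlim (\<lambda>t. 1 / (2 * c) * (- Re u + sqrt (Re (u\<^sup>2) + 4 * c * t))) at_top at_top" .
    show "\<forall>\<^sub>F t in at_top. 1 / (2 * c) * (- Re u + sqrt (Re (u\<^sup>2) + 4 * c * t)) \<le> Re (X t)"
      using eventually_ge_at_top[of 0]
    proof eventually_elim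
      case (elim t)
      have "Re (u\<^sup>2) + 4 * c * t = (Re (u * v t))\<^sup>2 - (Im (u * v t))\<^sup>2"
        using arg_cong[OF sq[of t], of Re] by (simp only: Re_power2 plus_complex.sel Re_complex_of_real)
      then have "Re (u\<^sup>2) + 4 * c * t \<le> (Re (u * v t))\<^sup>2" by simp
      then have "sqrt (Re (u\<^sup>2) + 4 * c * t) \<le> Re (u * v t)"
        using bds(1)[OF elim] u by (intro real_le_lsqrt) auto
      then have "(- Re u + sqrt (Re (u\<^sup>2) + 4 * c * t)) / (2 * c) \<le> (Re (u * v t) - Re u) / (2 * c)"
        using c by (intro divide_right_mono) auto
      then show ?case by (simp add: ReX del: Re_power2 times_complex.sel)
    qed
  qed
  have diff: "((\<lambda>t. F (X t) - F (complex_of_real (Re (X t)))) \<longlongrightarrow> 0) at_top"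
  proof (rule Lim_null_comparison)
    define b where "b = \<bar>Im u\<bar> / c"
    show "\<forall>\<^sub>F t in at_top. norm (F (X t) - F (complex_of_real (Re (X t)))) \<le>
        b * exp (c * b\<^sup>2 + \<bar>Im u\<bar> * b) * exp (- Re u * Re (X t))"
      using eventually_ge_at_top[of 0]
    proof eventually_elim
      case (elim t)
      have "\<bar>Im (u * v t) - Im u\<bar> \<le> 2 * \<bar>Im u\<bar>" using bds(2)[OF elim] by linarith
      then have "\<bar>Im (u * v t) - Im u\<bar> / (2 * c) \<le> 2 * \<bar>Im u\<bar> / (2 * c)"
        using c by (intro divide_right_mono) auto
      then have "\<bar>Im (X t)\<bar> \<le> b" using c by (simp add: ReX(2) b_def abs_divide del: times_complex.sel)
      moreover have "Re (X t) \<ge> 0" using bds(1)[OF elim] c by (simp add: ReX(1) del: times_complex.sel)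
      ultimately show ?case
        using c F unfolding f_def by (intro gaussian_contour_shift) auto
    qed
    show "((\<lambda>t. b * exp (c * b\<^sup>2 + \<bar>Im u\<bar> * b) * exp (- Re u * Re (X t))) \<longlongrightarrow> 0) at_top"
      using filterlim_compose[OF tendsto_exp_minus_at_top[OF u] ReX_top]
      by (intro tendsto_mult_right_zero)
  qed
  have limF: "((\<lambda>t. u * F (X t)) \<longlongrightarrow> u * (laplace (\<lambda>x. exp (- (c * x\<^sup>2))) u + F 0)) at_top"
  proof -
    have "((\<lambda>t. u * ((F (X t) - F (complex_of_real (Re (X t)))) + ((F (complex_of_real (Re (X t))) - F 0) + F 0)))
        \<longlongrightarrow> u * (0 + (laplace (\<lambda>x. exp (- (c * x\<^sup>2))) u + F 0))) at_top"
      by (intro tendsto_intros diff filterlim_compose[OF lap ReX_top])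
    then show ?thesis by simp
  qed
  have "((\<lambda>t. exp (- complex_of_real t) / v t) has_integral
      (u * (laplace (\<lambda>x. exp (- (c * x\<^sup>2))) u + F 0) - u * F (X 0))) {0..}"
  proof (rule has_integral_half_line[OF ai _ limF])
    fix t :: real assume t: "t \<ge> 0"
    have "complex_of_real c * (X t)\<^sup>2 + u * X t = ((u * v t)\<^sup>2 - u\<^sup>2) / (4 * complex_of_real c)"
      using c by (simp add: X_def field_simps power2_eq_square)
    also have "\<dots> = complex_of_real t" unfolding sq using c by simp
    finally have "complex_of_real c * (X t)\<^sup>2 + u * X t = complex_of_real t" .
    moreover have "- (complex_of_real c * (X t)\<^sup>2) - u * X t = - (complex_of_real c * (X t)\<^sup>2 + u * X t)"
      by simp
    ultimately have "- (complex_of_real c * (X t)\<^sup>2) - u * X t = - complex_of_real t" by simp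
    then have fX: "f (X t) = exp (- complex_of_real t)" by (simp add: f_def)
    have "((\<lambda>s. (u * csqrt (1 - z * s) - u) / (2 * complex_of_real c)) has_field_derivative
        (u * (- z / (2 * v t)) / (2 * complex_of_real c))) (at (complex_of_real t))"
      unfolding v_def using slit[OF t] c by (auto intro!: derivative_eq_intros simp: mult_ac)
    also have "u * (- z / (2 * v t)) / (2 * complex_of_real c) = 1 / (u * v t)"
      using c u0 v0[OF t] by (simp add: z field_simps power2_eq_square)
    finally have dX: "((\<lambda>s. (u * csqrt (1 - z * s) - u) / (2 * complex_of_real c))
        has_field_derivative 1 / (u * v t)) (at (complex_of_real t))" .
    have "((\<lambda>s. u * F ((u * csqrt (1 - z * s) - u) / (2 * complex_of_real c)))
        has_field_derivative u * (f (X t) * (1 / (u * v t)))) (at (complex_of_real t))"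
      by (rule DERIV_cmult, rule DERIV_chain2[OF _ dX]) (use F in \<open>simp add: X_def v_def\<close>)
    also have "u * (f (X t) * (1 / (u * v t))) = exp (- complex_of_real t) / v t"
      using u0 by (simp add: fX)
    finally have "((\<lambda>s. u * F ((u * csqrt (1 - z * s) - u) / (2 * complex_of_real c)))
        has_field_derivative exp (- complex_of_real t) / v t) (at (complex_of_real t))" .
    then show "((\<lambda>t. u * F (X t)) has_vector_derivative exp (- complex_of_real t) / v t) (at t within {0..})"
      unfolding X_def v_def by (rule has_vector_derivative_real_field)
  qed
  also have "X 0 = 0" by (simp add: X_def v_def)
  finally have "((\<lambda>t. exp (- complex_of_real t) / v t) has_integral
      (u * laplace (\<lambda>x. exp (- (c * x\<^sup>2))) u)) {0..}"
    by (simp add: algebra_simps)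
  then show ?thesis
    by (rule has_integral_eq[rotated]) (use integrand in auto)
qed

text \<open>
  For \<open>c > 0\<close> the series diverges and its Borel sum is the integral along the deformed path;
  for \<open>c = 0\<close> it terminates after the first term.
\<close>
lemma laplace_gaussian:
  assumes c: "c \<ge> 0" and u: "Re u > 0"
  shows "laplace (\<lambda>x. exp (- (c * x\<^sup>2))) u =
    1 / u * hypergeometric [1/2, 1] [] (- (4 * complex_of_real c / u\<^sup>2))"
proof (cases "c = 0")
  case True
  have "(\<lambda>n. term_2F0 (0::complex) n) = (\<lambda>n. if n = 0 then 1 else 0)"
    unfolding hypergeo_2F0_nth by auto
  then have "hypergeometric [1/2, 1] [] 0 = 1"
    using sums_If_finite_set[of "{0}" "\<lambda>_. 1 :: complex"]
    by (simp add: hypergeometric_def sums_iff)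
  then show ?thesis using True laplace_one[OF u] by simp
next
  case False
  then have "c > 0" using c by simp
  then have "hypergeometric [1/2, 1] [] (- (4 * complex_of_real c / u\<^sup>2)) =
      u * laplace (\<lambda>x. exp (- (c * x\<^sup>2))) u"
    using gaussian_contour u minus_divide_square_not_nonneg
    by (intro hypergeometric_2F0_eq) auto
  moreover have "u \<noteq> 0" using u by auto
  ultimately show ?thesis by simp
qed

section \<open>The error function\<close>

lemma erf_zero: "erf 0 = 0"
  by (simp add: erf_def)

lemma erf_deriv:
  assumes "x \<ge> 0"
  shows "(erf has_real_derivative exp (- (x\<^sup>2))) (at x)"
proof -
  have "((\<lambda>y. LBINT v=ereal 0..ereal y. exp (- (v\<^sup>2))) has_vector_derivative exp (- (x\<^sup>2)))
      (at x within {-1..x+1})"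
    using assms by (intro interval_integral_FTC2 continuous_intros) auto
  moreover have "at x within {-1..x+1} = at x"
    using assms by (intro at_within_interior) auto
  ultimately show ?thesis
    by (simp add: has_real_derivative_iff_has_vector_derivative erf_def[abs_def])
qed

text \<open>
  The integrand is at most \<open>1 / (1 + v\<^sup>2)\<close>, the derivative of the arctangent.
\<close>
lemma erf_bounded:
  assumes "x \<ge> 0"
  shows "\<bar>erf x\<bar> \<le> pi / 2"
proof -
  have "erf 0 \<le> erf x"
  proof (rule DERIV_nonneg_imp_nondecreasing[OF assms])
    fix y :: real assume "0 \<le> y" "y \<le> x"
    then show "\<exists>d. (erf has_real_derivative d) (at y) \<and> d \<ge> 0"
      using erf_deriv[of y] exp_ge_zero by blast
  qed
  moreover have "arctan 0 - erf 0 \<le> arctan x - erf x"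
  proof (rule DERIV_nonneg_imp_nondecreasing[OF assms])
    fix y :: real assume y: "0 \<le> y" "y \<le> x"
    have "1 + y\<^sup>2 \<le> exp (y\<^sup>2)" using exp_ge_add_one_self by simp
    then have "inverse (exp (y\<^sup>2)) \<le> inverse (1 + y\<^sup>2)"
      by (intro le_imp_inverse_le) (auto intro: add_pos_nonneg)
    then have "inverse (1 + y\<^sup>2) - exp (- (y\<^sup>2)) \<ge> 0" by (simp add: exp_minus)
    moreover have "((\<lambda>y. arctan y - erf y) has_real_derivative inverse (1 + y\<^sup>2) - exp (- (y\<^sup>2))) (at y)"
      by (intro DERIV_diff DERIV_arctan erf_deriv y)
    ultimately show "\<exists>d. ((\<lambda>y. arctan y - erf y) has_real_derivative d) (at y) \<and> d \<ge> 0" by blast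
  qed
  moreover have "arctan x < pi / 2" by (rule arctan_ubound)
  ultimately show ?thesis by (simp add: erf_zero)
qed

lemma laplace_erf:
  assumes u: "Re u > 0"
  shows "laplace_exists erf u" "laplace erf u = 1 / u * laplace (\<lambda>x. exp (- (x\<^sup>2))) u"
proof -
  have "continuous_on {0..} erf"
    using erf_deriv by (intro continuous_at_imp_continuous_on) (auto intro: DERIV_isCont)
  then show "laplace_exists erf u" by (rule laplace_exists_bounded[OF u]) (rule erf_bounded)
  have "laplace (\<lambda>x. exp (- (x\<^sup>2))) u = u * laplace erf u - complex_of_real (erf 0)"
    by (rule laplace_deriv[OF u erf_deriv _ erf_bounded, where B' = 1]) (auto intro!: continuous_intros)
  moreover have "u \<noteq> 0" using u by auto
  ultimately show "laplace erf u = 1 / u * laplace (\<lambda>x. exp (- (x\<^sup>2))) u" by (simp add: erf_zero)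
qed

theorem corollary1:
  fixes \<theta> :: real and u :: complex
  assumes "Re u > 0"
  shows "laplace_exists (\<lambda>x. exp (- (\<theta>\<^sup>2 * x\<^sup>2))) u \<and>
         laplace (\<lambda>x. exp (- (\<theta>\<^sup>2 * x\<^sup>2))) u =
           1 / u * hypergeometric [1/2, 1] [] (- (4 * (complex_of_real \<theta>)\<^sup>2 / u\<^sup>2)) \<and>
         asymptotic_series (laplace (\<lambda>x. exp (- (\<theta>\<^sup>2 * x\<^sup>2))))
           (\<lambda>n s. 1 / s * fps_hypergeo [1/2, 1] [] (- (4 * (complex_of_real \<theta>)\<^sup>2 / s\<^sup>2)) $ n) \<and>
         laplace_exists erf u \<and>
         laplace erf u = 1 / u * laplace (\<lambda>x. exp (- (x\<^sup>2))) u \<and>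
         1 / u * laplace (\<lambda>x. exp (- (x\<^sup>2))) u =
           1 / u\<^sup>2 * hypergeometric [1/2, 1] [] (- (4 / u\<^sup>2)) \<and>
         asymptotic_series (laplace erf)
           (\<lambda>n s. 1 / s\<^sup>2 * fps_hypergeo [1/2, 1] [] (- (4 / s\<^sup>2)) $ n)"
proof (intro conjI)
  show "laplace_exists (\<lambda>x. exp (- (\<theta>\<^sup>2 * x\<^sup>2))) u"
    by (intro laplace_exists_bounded[where B = 1] assms continuous_intros) auto
  show "laplace (\<lambda>x. exp (- (\<theta>\<^sup>2 * x\<^sup>2))) u =
           1 / u * hypergeometric [1/2, 1] [] (- (4 * (complex_of_real \<theta>)\<^sup>2 / u\<^sup>2))"
    using laplace_gaussian[of "\<theta>\<^sup>2" u] assms by simp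
  show "asymptotic_series (laplace (\<lambda>x. exp (- (\<theta>\<^sup>2 * x\<^sup>2))))
           (\<lambda>n s. 1 / s * fps_hypergeo [1/2, 1] [] (- (4 * (complex_of_real \<theta>)\<^sup>2 / s\<^sup>2)) $ n)"
    using gaussian_asymptotic_series[of "\<theta>\<^sup>2"] by simp
  show "laplace_exists erf u" "laplace erf u = 1 / u * laplace (\<lambda>x. exp (- (x\<^sup>2))) u"
    using laplace_erf[OF assms] .
  show "1 / u * laplace (\<lambda>x. exp (- (x\<^sup>2))) u =
           1 / u\<^sup>2 * hypergeometric [1/2, 1] [] (- (4 / u\<^sup>2))"
    using laplace_gaussian[of 1 u] assms by (simp add: power2_eq_square)
  show "asymptotic_series (laplace erf)
           (\<lambda>n s. 1 / s\<^sup>2 * fps_hypergeo [1/2, 1] [] (- (4 / s\<^sup>2)) $ n)"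
    by (rule asymptotic_series_divide[OF gaussian_asymptotic_series[of 1]])
       (auto simp: laplace_erf power2_eq_square)
qed

end
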